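(* Let $m,B\ge 1$ be integers. For any given vector $(\bar\beta^\ell)_{\ell=1}^m$ with $\bar\beta^\ell\in[0,1]$ and $\sum_{\ell=1}^m\bar\beta^\ell\le B$, there exists a randomized algorithm, running in time $\mathcal O(m)$, that assigns $B$ inspectors to $m$ agents (each inspector inspecting at most one agent, and each agent being inspected by at most one inspector, in every realization) such that each agent $\ell\in\{1,\dots,m\}$ is inspected with probability $\bar\beta^\ell$.
   Context: There are $B$ inspectors and $m$ agents. Each inspector has one unit of inspection, i.e. can inspect at most one agent, and each agent may be inspected by at most one inspector. The vector $(\bar\beta^\ell)_{\ell=1}^m$ is an allocation of the inspection budget $B$: $\bar\beta^\ell$ is the target probability that agent $\ell$ is inspected. The algorithm may draw uniform random variables on $[0,1]$, and time is counted in elementary operations on real numbers. *)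

theory Defs
  imports "HOL-Probability.Probability" "HOL-Library.Landau_Symbols"
begin

text \<open>
  A randomized real RAM. It has an unbounded memory of natural numbers (used for counters and
  addresses), an unbounded memory of real numbers, a read-only array of real inputs, a write-only
  output stream of pairs of naturals, and a source of independent uniform variates. The operands
  of an instruction are literal addresses, except for the constants of \<open>NConst\<close> and \<open>RConst\<close> and
  the targets of jumps. There is deliberately no rounding of reals.
\<close>

datatype instr =
    NConst nat nat
  | NAdd nat nat nat
  | NSub nat nat nat
  | NLoad nat nat
  | NStore nat nat
  | RConst nat nat
  | RAdd nat nat nat
  | RSub nat nat nat
  | RMul nat nat nat
  | RDiv nat nat nat
  | RLoad nat nat
  | RStore nat nat
  | RInput nat nat
  | Draw nat
  | Jump nat
  | JumpNLess nat nat nat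
  | JumpRLess nat nat nat
  | Emit nat nat

type_synonym program = "instr list"

record config =
  pc :: nat
  nmem :: "nat \<Rightarrow> nat"
  rmem :: "nat \<Rightarrow> real"
  draws :: nat
  emitted :: "(nat \<times> nat) list"

text \<open>
  \<open>x\<close> is the input array and \<open>\<omega>\<close> the sequence of uniform variates, of which \<open>draws c\<close> have been
  consumed. Jump targets are absolute, so every instruction first advances the program counter.
\<close>

fun exec_instr :: "(nat \<Rightarrow> real) \<Rightarrow> (nat \<Rightarrow> real) \<Rightarrow> instr \<Rightarrow> config \<Rightarrow> config" where
  "exec_instr x \<omega> (NConst i n) c = c\<lparr>nmem := (nmem c)(i := n)\<rparr>"
| "exec_instr x \<omega> (NAdd i j k) c = c\<lparr>nmem := (nmem c)(i := nmem c j + nmem c k)\<rparr>"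
| "exec_instr x \<omega> (NSub i j k) c = c\<lparr>nmem := (nmem c)(i := nmem c j - nmem c k)\<rparr>"
| "exec_instr x \<omega> (NLoad i j) c = c\<lparr>nmem := (nmem c)(i := nmem c (nmem c j))\<rparr>"
| "exec_instr x \<omega> (NStore i j) c = c\<lparr>nmem := (nmem c)(nmem c i := nmem c j)\<rparr>"
| "exec_instr x \<omega> (RConst i n) c = c\<lparr>rmem := (rmem c)(i := real n)\<rparr>"
| "exec_instr x \<omega> (RAdd i j k) c = c\<lparr>rmem := (rmem c)(i := rmem c j + rmem c k)\<rparr>"
| "exec_instr x \<omega> (RSub i j k) c = c\<lparr>rmem := (rmem c)(i := rmem c j - rmem c k)\<rparr>"
| "exec_instr x \<omega> (RMul i j k) c = c\<lparr>rmem := (rmem c)(i := rmem c j * rmem c k)\<rparr>"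
| "exec_instr x \<omega> (RDiv i j k) c = c\<lparr>rmem := (rmem c)(i := rmem c j / rmem c k)\<rparr>"
| "exec_instr x \<omega> (RLoad i j) c = c\<lparr>rmem := (rmem c)(i := rmem c (nmem c j))\<rparr>"
| "exec_instr x \<omega> (RStore i j) c = c\<lparr>rmem := (rmem c)(nmem c i := rmem c j)\<rparr>"
| "exec_instr x \<omega> (RInput i j) c = c\<lparr>rmem := (rmem c)(i := x (nmem c j))\<rparr>"
| "exec_instr x \<omega> (Draw i) c =
     c\<lparr>rmem := (rmem c)(i := \<omega> (draws c)), draws := Suc (draws c)\<rparr>"
| "exec_instr x \<omega> (Jump a) c = c\<lparr>pc := a\<rparr>"
| "exec_instr x \<omega> (JumpNLess i j a) c = (if nmem c i < nmem c j then c\<lparr>pc := a\<rparr> else c)"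
| "exec_instr x \<omega> (JumpRLess i j a) c = (if rmem c i < rmem c j then c\<lparr>pc := a\<rparr> else c)"
| "exec_instr x \<omega> (Emit i j) c = c\<lparr>emitted := emitted c @ [(nmem c i, nmem c j)]\<rparr>"

definition halted :: "program \<Rightarrow> config \<Rightarrow> bool" where
  "halted P c \<longleftrightarrow> length P \<le> pc c"

definition step :: "program \<Rightarrow> (nat \<Rightarrow> real) \<Rightarrow> (nat \<Rightarrow> real) \<Rightarrow> config \<Rightarrow> config" where
  "step P x \<omega> c =
     (if halted P c then c else exec_instr x \<omega> (P ! pc c) (c\<lparr>pc := Suc (pc c)\<rparr>))"

text \<open>The two integer parameters of the problem are passed in the first two natural cells.\<close>

definition init_config :: "nat \<Rightarrow> nat \<Rightarrow> config" where
  "init_config m B =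
     \<lparr>pc = 0, nmem = (\<lambda>_. 0)(0 := m, 1 := B), rmem = (\<lambda>_. 0), draws = 0, emitted = []\<rparr>"

definition config_after ::
    "program \<Rightarrow> nat \<Rightarrow> nat \<Rightarrow> (nat \<Rightarrow> real) \<Rightarrow> (nat \<Rightarrow> real) \<Rightarrow> nat \<Rightarrow> config" where
  "config_after P m B x \<omega> n = (step P x \<omega> ^^ n) (init_config m B)"

definition terminates ::
    "program \<Rightarrow> nat \<Rightarrow> nat \<Rightarrow> (nat \<Rightarrow> real) \<Rightarrow> (nat \<Rightarrow> real) \<Rightarrow> bool" where
  "terminates P m B x \<omega> \<longleftrightarrow> (\<exists>n. halted P (config_after P m B x \<omega> n))"

text \<open>
  Every executed instruction costs one unit, bookkeeping on naturals and output included. Running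
  time and output are meaningful only for terminating runs.
\<close>

definition running_time ::
    "program \<Rightarrow> nat \<Rightarrow> nat \<Rightarrow> (nat \<Rightarrow> real) \<Rightarrow> (nat \<Rightarrow> real) \<Rightarrow> nat" where
  "running_time P m B x \<omega> = (LEAST n. halted P (config_after P m B x \<omega> n))"

definition output_pairs ::
    "program \<Rightarrow> nat \<Rightarrow> nat \<Rightarrow> (nat \<Rightarrow> real) \<Rightarrow> (nat \<Rightarrow> real) \<Rightarrow> (nat \<times> nat) set" where
  "output_pairs P m B x \<omega> = set (emitted (config_after P m B x \<omega> (running_time P m B x \<omega>)))"

text \<open>
  Independent uniform variates on \<open>[0,1]\<close>. The space of this measure is exactly the set of
  sequences with values in \<open>[0,1]\<close>, so it is the set of all realizations.
\<close>

definition uniform_seq :: "(nat \<Rightarrow> real) measure" where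
  "uniform_seq = Pi\<^sub>M UNIV (\<lambda>_. restrict_space lborel {0..1})"

lemma space_uniform_seq: "space uniform_seq = {\<omega>. \<forall>i. \<omega> i \<in> {0..1}}"
  by (auto simp: uniform_seq_def space_PiM space_restrict_space)

lemma prob_space_uniform_seq: "prob_space uniform_seq"
proof -
  have "prob_space (restrict_space lborel {0..1::real})"
    by (intro prob_spaceI) (simp add: space_restrict_space emeasure_restrict_space)
  then show ?thesis
    unfolding uniform_seq_def by (intro prob_space_PiM)
qed

text \<open>A pair \<open>(j, l)\<close> means that inspector \<open>j\<close> inspects agent \<open>l\<close>; inspectors may stay idle.\<close>

definition is_assignment :: "nat \<Rightarrow> nat \<Rightarrow> (nat \<times> nat) set \<Rightarrow> bool" where
  "is_assignment B m A \<longleftrightarrow>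
     A \<subseteq> {1..B} \<times> {1..m} \<and> single_valued A \<and> single_valued (A\<inverse>)"

definition inspected :: "(nat \<times> nat) set \<Rightarrow> nat \<Rightarrow> bool" where
  "inspected A l \<longleftrightarrow> (\<exists>j. (j, l) \<in> A)"

end

theory Submission
  imports Defs
begin

text \<open>
  The algorithm is systematic sampling. Lay the agents out on the real line as consecutive
  half-open intervals of lengths \<open>\<beta> 1, \<beta> 2, \<dots>\<close>, draw a single uniform variate \<open>u\<close>, and let
  inspector \<open>i + 1\<close> inspect the agent whose interval contains \<open>u + i\<close>. The intervals are disjoint
  and of length at most 1, so the result is a matching, and they all lie in \<open>[0, B)\<close>, so \<open>B\<close>
  inspectors suffice. An agent is inspected iff its interval, folded modulo 1, contains \<open>u\<close>, which
  has probability equal to its length. A single sweep over the agents computes the matching.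
\<close>

section \<open>Systematic sampling\<close>

definition psum :: "(nat \<Rightarrow> real) \<Rightarrow> nat \<Rightarrow> real" where
  "psum \<beta> l = (\<Sum>i=1..l. \<beta> i)"

text \<open>Here \<open>i\<close> and \<open>l\<close> count from 0, whereas inspectors and agents
  count from 1. Half-open intervals leave no sampling point to two agents.\<close>

definition sampling :: "(nat \<Rightarrow> real) \<Rightarrow> nat \<Rightarrow> real \<Rightarrow> (nat \<times> nat) set" where
  "sampling \<beta> m u =
     {(Suc i, Suc l) | i l. l < m \<and> psum \<beta> l \<le> u + real i \<and> u + real i < psum \<beta> (Suc l)}"

lemma psum_0 [simp]: "psum \<beta> 0 = 0"
  by (simp add: psum_def)

lemma psum_Suc [simp]: "psum \<beta> (Suc l) = psum \<beta> l + \<beta> (Suc l)"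
  by (simp add: psum_def)

lemma psum_mono:
  assumes "\<forall>l\<in>{1..m}. 0 \<le> \<beta> l" "k \<le> l" "l \<le> m"
  shows "psum \<beta> k \<le> psum \<beta> l"
  unfolding psum_def using assms by (intro sum_mono2) auto

lemma sampling_0 [simp]: "sampling \<beta> 0 u = {}"
  by (simp add: sampling_def)

lemma sampling_Suc:
  "sampling \<beta> (Suc l) u = sampling \<beta> l u \<union>
     {(Suc i, Suc l) | i. psum \<beta> l \<le> u + real i \<and> u + real i < psum \<beta> (Suc l)}"
  by (auto simp: sampling_def less_Suc_eq)

lemma is_assignment_sampling:
  assumes \<beta>: "\<forall>l\<in>{1..m}. \<beta> l \<in> {0..1}" and B: "psum \<beta> m \<le> real B" and u: "0 \<le> u"
  shows "is_assignment B m (sampling \<beta> m u)"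
proof -
  have nonneg: "\<forall>l\<in>{1..m}. 0 \<le> \<beta> l" using \<beta> by auto
  have "i < B" if "l < m" "u + real i < psum \<beta> (Suc l)" for i l
  proof -
    have "psum \<beta> (Suc l) \<le> psum \<beta> m"
      using that by (intro psum_mono[OF nonneg]) auto
    with that B u have "real i < real B" by linarith
    then show ?thesis by simp
  qed
  moreover have False
    if "l < l'" "l' < m" "u + real i < psum \<beta> (Suc l)" "psum \<beta> l' \<le> u + real i" for i l l'
    using psum_mono[OF nonneg, of "Suc l" l'] that by simp
  then have "l = l'"
    if "l < m" "l' < m" "u + real i < psum \<beta> (Suc l)" "psum \<beta> l \<le> u + real i"
      "u + real i < psum \<beta> (Suc l')" "psum \<beta> l' \<le> u + real i" for i l l'
    using that by (meson linorder_less_linear)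
  \<comment> \<open>Two points of a half-open interval of length at most 1 differ by less than 1,
    while sampling points have integer distances.\<close>
  moreover have "i = i'"
    if "l < m" "psum \<beta> l \<le> u + real i" "u + real i < psum \<beta> (Suc l)"
      "psum \<beta> l \<le> u + real i'" "u + real i' < psum \<beta> (Suc l)" for i i' l
  proof -
    have "\<beta> (Suc l) \<le> 1" using \<beta> that by auto
    with that have "\<bar>real i - real i'\<bar> < 1" by simp
    then show ?thesis by linarith
  qed
  ultimately show ?thesis
    unfolding is_assignment_def single_valued_def sampling_def by (auto simp: Suc_le_eq)
qed

lemma inspected_sampling:
  "inspected (sampling \<beta> m u) (Suc l) \<longleftrightarrow>
     l < m \<and> (\<exists>i. psum \<beta> l \<le> u + real i \<and> u + real i < psum \<beta> (Suc l))"
  by (auto simp: inspected_def sampling_def)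

section \<open>Inspection probabilities\<close>

text \<open>The point 1 can also be hit by an interval that starts at an integer, so it is left out.\<close>

lemma folded_interval:
  fixes a b :: real
  assumes "0 \<le> a" "a \<le> b" "b \<le> a + 1"
  defines "f \<equiv> a - of_int \<lfloor>a\<rfloor>" and "g \<equiv> b - of_int \<lfloor>a\<rfloor>"
  shows "{u\<in>{0..1}. \<exists>i. a \<le> u + real i \<and> u + real i < b} - {1} =
    {f..<min g 1} \<union> {0..<g - 1}"
proof (rule set_eqI)
  fix u
  define n where "n = nat \<lfloor>a\<rfloor>"
  have fl: "of_int \<lfloor>a\<rfloor> = real n"
    using assms(1) by (simp add: n_def)
  have n: "real n \<le> a" "a < real n + 1"
    using fl of_int_floor_le[of a] real_of_int_floor_add_one_gt[of a] by auto
  show "u \<in> {u\<in>{0..1}. \<exists>i. a \<le> u + real i \<and> u + real i < b} - {1} \<longleftrightarrow>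
      u \<in> {f..<min g 1} \<union> {0..<g - 1}" (is "?L \<longleftrightarrow> ?R")
  proof
    assume ?L
    then obtain i where u: "0 \<le> u" "u < 1" and i: "a \<le> u + real i" "u + real i < b"
      by force
    \<comment> \<open>Since \<open>a\<close> lies in \<open>[n, n + 1)\<close> and
      \<open>b < n + 2\<close>, only \<open>u + n\<close> and \<open>u + n + 1\<close> can hit the
      interval; they yield the two pieces.\<close>
    have "real n < real i + 1" "real i < real n + 2"
      using n u i assms by linarith+
    then have "i = n \<or> i = Suc n" by linarith
    then show ?R
      using u i n fl by (auto simp: f_def g_def)
  next
    assume ?R
    then show ?L
    proof
      assume "u \<in> {f..<min g 1}"
      then show ?L
        using n fl by (auto simp: f_def g_def intro!: exI[of _ n])
    next
      assume "u \<in> {0..<g - 1}"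
      then show ?L
        using n fl assms(3) by (auto simp: f_def g_def intro!: exI[of _ "Suc n"])
    qed
  qed
qed

text \<open>The two pieces are disjoint because \<open>g - 1 \<le> f\<close>, their lengths add up
  to \<open>g - f\<close>, and the point 1 left out is a null set.\<close>

lemma folded_interval_measure:
  fixes a b :: real
  assumes "0 \<le> a" "a \<le> b" "b \<le> a + 1"
  defines "A \<equiv> {u\<in>{0..1}. \<exists>i. a \<le> u + real i \<and> u + real i < b}"
  shows "A \<in> sets borel" and "measure lborel A = b - a"
proof -
  define f g where fg: "f = a - of_int \<lfloor>a\<rfloor>" "g = b - of_int \<lfloor>a\<rfloor>"
  have f: "0 \<le> f" "f < 1" and g: "f \<le> g" "g \<le> f + 1"
    unfolding fg using assms by linarith+
  have A: "A - {1} = {f..<min g 1} \<union> {0..<g - 1}"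
    unfolding A_def fg using folded_interval[OF assms(1-3)] .
  show "A \<in> sets borel"
    unfolding A_def by measurable
  then have "A \<in> sets lborel" by simp
  then have "measure lborel A = measure lborel (A - {1})"
    unfolding measure_def by (subst emeasure_Diff_null_set) (auto simp: null_sets_def)
  also have "\<dots> = measure lborel {f..<min g 1} + measure lborel {0..<g - 1}"
    unfolding A using f g by (intro measure_Union; cases "1 \<le> g") auto
  also have "\<dots> = b - a"
    using f g by (auto simp: min_def fg)
  finally show "measure lborel A = b - a" .
qed

text \<open>Every coordinate of the product measure has the uniform law as its marginal.\<close>

lemma measure_uniform_seq_component:
  assumes "A \<in> sets borel" "A \<subseteq> {0..1}"
  shows "{\<omega>\<in>space uniform_seq. \<omega> k \<in> A} \<in> sets uniform_seq"
    and "measure uniform_seq {\<omega>\<in>space uniform_seq. \<omega> k \<in> A} = measure lborel A"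
proof -
  let ?M = "restrict_space lborel {0..1::real}"
  have pm: "prob_space ?M"
    by (intro prob_spaceI) (simp add: space_restrict_space emeasure_restrict_space)
  have distr: "distr uniform_seq ?M (\<lambda>\<omega>. \<omega> k) = ?M"
    unfolding uniform_seq_def using pm by (intro distr_PiM_component) auto
  have meas: "(\<lambda>\<omega>. \<omega> k) \<in> uniform_seq \<rightarrow>\<^sub>M ?M"
    unfolding uniform_seq_def by measurable
  have A: "A \<in> sets ?M"
    using assms by (auto simp: sets_restrict_space_iff)
  have eq: "{\<omega>\<in>space uniform_seq. \<omega> k \<in> A} = (\<lambda>\<omega>. \<omega> k) -` A \<inter> space uniform_seq"
    by auto
  show "{\<omega>\<in>space uniform_seq. \<omega> k \<in> A} \<in> sets uniform_seq"
    unfolding eq using measurable_sets[OF meas A] .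
  show "measure uniform_seq {\<omega>\<in>space uniform_seq. \<omega> k \<in> A} = measure lborel A"
    unfolding eq measure_distr[OF meas A, symmetric] distr
    using assms by (simp add: measure_restrict_space)
qed

text \<open>The event depends on \<open>\<omega> 0\<close> alone: it says that this variate lies in
  the folded interval of agent \<open>l\<close>.\<close>

lemma inspection_probability:
  assumes \<beta>: "\<forall>l\<in>{1..m}. \<beta> l \<in> {0..1}" and l: "l \<in> {1..m}"
  defines "E \<equiv> {\<omega>\<in>space uniform_seq. inspected (sampling \<beta> m (\<omega> 0)) l}"
  shows "E \<in> sets uniform_seq" and "measure uniform_seq E = \<beta> l"
proof -
  obtain k where k: "l = Suc k" "k < m"
    using l by (cases l) auto
  let ?A = "{u\<in>{0..1}. \<exists>i. psum \<beta> k \<le> u + real i \<and> u + real i < psum \<beta> (Suc k)}"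
  have E: "E = {\<omega>\<in>space uniform_seq. \<omega> 0 \<in> ?A}"
    using k by (auto simp: E_def inspected_sampling space_uniform_seq)
  have "psum \<beta> 0 \<le> psum \<beta> k"
    using \<beta> k by (intro psum_mono[of m]) auto
  then have ab: "0 \<le> psum \<beta> k" "psum \<beta> k \<le> psum \<beta> (Suc k)" "psum \<beta> (Suc k) \<le> psum \<beta> k + 1"
    using \<beta> l k by auto
  note A = folded_interval_measure[OF ab]
  have "?A \<subseteq> {0..1}" by blast
  note C = measure_uniform_seq_component[OF A(1) this, of 0]
  show "E \<in> sets uniform_seq"
    unfolding E by (rule C(1))
  show "measure uniform_seq E = \<beta> l"
    unfolding E C(2) A(2) by (simp add: k)
qed

section \<open>The program\<close>

text \<open>
  Natural cells: 0 holds \<open>m\<close>, 2 the current agent, 3 the constant 1, 4 the next inspector.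
  Real cells: 0 holds the next sampling point \<open>u + i\<close>, 1 the partial sum, 2 the current \<open>\<beta> l\<close>,
  3 the constant 1. The loop body runs from 4 to 12; its test comes last because \<open>m \<ge> 1\<close>.
  An agent needs at most one comparison, since \<open>\<beta> l \<le> 1\<close>.
\<close>

definition sampler :: program where
  "sampler =
    [NConst 3 1, NConst 4 1, RConst 3 1, Draw 0,
     NAdd 2 2 3, RInput 2 2, RAdd 1 1 2, JumpRLess 0 1 9, Jump 12,
     Emit 4 2, NAdd 4 4 3, RAdd 0 0 3, JumpNLess 2 0 4]"

text \<open>\<open>i\<close> is the number of sampling points that lie below the current partial sum.\<close>

definition sampler_inv ::
    "nat \<Rightarrow> (nat \<Rightarrow> real) \<Rightarrow> real \<Rightarrow> nat \<Rightarrow> config \<Rightarrow> bool" where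
  "sampler_inv m \<beta> u l c \<longleftrightarrow>
     pc c = (if l < m then 4 else 13) \<and>
     nmem c 0 = m \<and> nmem c 2 = l \<and> nmem c 3 = 1 \<and> rmem c 3 = 1 \<and> rmem c 1 = psum \<beta> l \<and>
     (\<exists>i. nmem c 4 = Suc i \<and> rmem c 0 = u + real i \<and>
        (\<forall>j. u + real j < psum \<beta> l \<longleftrightarrow> j < i)) \<and>
     set (emitted c) = sampling \<beta> l u"

text \<open>Peels off the first step, so that the simplifier can run the program symbolically from a
  known configuration.\<close>

lemma funpow_numeral_simps:
  "(f ^^ numeral k) x = (f ^^ pred_numeral k) (f x)"
  by (simp add: numeral_eq_Suc funpow_swap1)

lemma sampler_loop:
  assumes inv: "sampler_inv m \<beta> u l c" and l: "l < m" and \<beta>: "\<beta> (Suc l) \<in> {0..1}"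
  shows "\<exists>n\<le>8. sampler_inv m \<beta> u (Suc l) ((step sampler \<beta> \<omega> ^^ n) c)"
proof -
  from inv obtain i where
    c: "pc c = 4" "nmem c 0 = m" "nmem c 2 = l"
      "nmem c 3 = 1" "rmem c 3 = 1" "rmem c 1 = psum \<beta> l" "nmem c 4 = Suc i"
      "rmem c 0 = u + real i" "set (emitted c) = sampling \<beta> l u"
    and i: "\<And>j. u + real j < psum \<beta> l \<longleftrightarrow> j < i"
    using l by (auto simp: sampler_inv_def)
  have ge: "psum \<beta> l \<le> u + real i" using i[of i] by simp
  show ?thesis
  proof (cases "u + real i < psum \<beta> (Suc l)")
    case True
    \<comment> \<open>As \<open>\<beta> (Suc l) \<le> 1\<close>, the point after
      \<open>u + real i\<close> is not below the new sum: exactly one point is added.\<close>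
    have below: "u + real j < psum \<beta> (Suc l) \<longleftrightarrow> j < Suc i" for j
    proof
      assume "u + real j < psum \<beta> (Suc l)"
      then have "u + real j < psum \<beta> l + 1" using \<beta> by simp
      with ge have "real j < real i + 1" by linarith
      then show "j < Suc i" by linarith
    next
      assume "j < Suc i"
      then have "real j \<le> real i" by simp
      with True show "u + real j < psum \<beta> (Suc l)" by linarith
    qed
    have "{(Suc j, Suc l) | j. psum \<beta> l \<le> u + real j \<and> u + real j < psum \<beta> (Suc l)} =
        {(Suc i, Suc l)}"
      unfolding below not_less[symmetric] i by auto
    then have "sampling \<beta> (Suc l) u = insert (Suc i, Suc l) (sampling \<beta> l u)"
      unfolding sampling_Suc by simp
    \<comment> \<open>The loop body without \<open>Jump 12\<close> has 8 instructions.\<close>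
    then have "sampler_inv m \<beta> u (Suc l) ((step sampler \<beta> \<omega> ^^ 8) c)"
      using True below c
      by (simp add: sampler_inv_def funpow_numeral_simps step_def halted_def sampler_def)
    then show ?thesis by blast
  next
    case False
    have below: "u + real j < psum \<beta> (Suc l) \<longleftrightarrow> j < i" for j
    proof
      assume "u + real j < psum \<beta> (Suc l)"
      with False have "real j < real i" by linarith
      then show "j < i" by simp
    next
      assume "j < i"
      then show "u + real j < psum \<beta> (Suc l)" using i[of j] \<beta> by simp
    qed
    have "sampling \<beta> (Suc l) u = sampling \<beta> l u"
      unfolding sampling_Suc below not_less[symmetric] i by auto
    \<comment> \<open>The comparison fails, so \<open>Jump 12\<close> replaces the three
      instructions that emit a pair and advance the inspector and the point.\<close>
    then have "sampler_inv m \<beta> u (Suc l) ((step sampler \<beta> \<omega> ^^ 6) c)"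
      using False below c
      by (simp add: sampler_inv_def funpow_numeral_simps step_def halted_def sampler_def)
    moreover have "(6::nat) \<le> 8" by simp
    ultimately show ?thesis by blast
  qed
qed

text \<open>Four initial instructions, then at most 8 per agent.\<close>

lemma sampler_reaches:
  assumes m: "1 \<le> m" and \<beta>: "\<forall>l\<in>{1..m}. \<beta> l \<in> {0..1}" and u: "0 \<le> \<omega> 0" and "l \<le> m"
  shows "\<exists>n\<le>4 + 8 * l. sampler_inv m \<beta> (\<omega> 0) l (config_after sampler m B \<beta> \<omega> n)"
  using \<open>l \<le> m\<close>
proof (induction l)
  case 0
  \<comment> \<open>No sampling point is negative, so the invariant starts with the count 0.\<close>
  have "\<not> \<omega> 0 + real j < 0" for j using u by simp
  then have "sampler_inv m \<beta> (\<omega> 0) 0 (config_after sampler m B \<beta> \<omega> 4)"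
    using m by (simp add: sampler_inv_def config_after_def init_config_def funpow_numeral_simps
        step_def halted_def sampler_def)
  then show ?case by auto
next
  case (Suc l)
  then obtain n where n: "n \<le> 4 + 8 * l"
    "sampler_inv m \<beta> (\<omega> 0) l (config_after sampler m B \<beta> \<omega> n)" by auto
  from sampler_loop[OF n(2), of \<omega>] Suc.prems \<beta> obtain k where "k \<le> 8"
    "sampler_inv m \<beta> (\<omega> 0) (Suc l) ((step sampler \<beta> \<omega> ^^ k) (config_after sampler m B \<beta> \<omega> n))"
    by auto
  with n(1) show ?case
    by (intro exI[of _ "k + n"]) (simp add: config_after_def funpow_add)
qed

section \<open>Termination, running time and output\<close>

lemma config_after_halted:
  assumes "halted P (config_after P m B x \<omega> n)" "n \<le> n'"
  shows "config_after P m B x \<omega> n' = config_after P m B x \<omega> n"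
  using \<open>n \<le> n'\<close>
proof (induction rule: dec_induct)
  case (step k)
  then show ?case
    using assms(1) by (simp add: config_after_def step_def)
qed simp

text \<open>A halted configuration never changes, so any halting time shows the final output and the
  least one need not be computed.\<close>

lemma halted_run:
  assumes "halted P (config_after P m B x \<omega> n)"
  shows "terminates P m B x \<omega>" and "running_time P m B x \<omega> \<le> n"
    and "output_pairs P m B x \<omega> = set (emitted (config_after P m B x \<omega> n))"
proof -
  show "terminates P m B x \<omega>"
    using assms by (auto simp: terminates_def)
  show le: "running_time P m B x \<omega> \<le> n"
    unfolding running_time_def using assms by (rule Least_le)
  have "halted P (config_after P m B x \<omega> (running_time P m B x \<omega>))"
    unfolding running_time_def using assms by (rule LeastI)
  from config_after_halted[OF this le]
  show "output_pairs P m B x \<omega> = set (emitted (config_after P m B x \<omega> n))"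
    by (simp add: output_pairs_def)
qed

lemma sampler_correct:
  assumes "1 \<le> m" "\<forall>l\<in>{1..m}. \<beta> l \<in> {0..1}" "0 \<le> \<omega> 0"
  shows "terminates sampler m B \<beta> \<omega>" and "running_time sampler m B \<beta> \<omega> \<le> 4 + 8 * m"
    and "output_pairs sampler m B \<beta> \<omega> = sampling \<beta> m (\<omega> 0)"
proof -
  obtain n where n: "n \<le> 4 + 8 * m"
    "sampler_inv m \<beta> (\<omega> 0) m (config_after sampler m B \<beta> \<omega> n)"
    using sampler_reaches[where \<omega> = \<omega> and l = m, OF assms] by auto
  \<comment> \<open>For \<open>l = m\<close> the invariant sets \<open>pc\<close> to 13, the length
    of the program.\<close>
  then have "halted sampler (config_after sampler m B \<beta> \<omega> n)"
    by (simp add: sampler_inv_def halted_def sampler_def)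
  note run = halted_run[OF this]
  show "terminates sampler m B \<beta> \<omega>" "running_time sampler m B \<beta> \<omega> \<le> 4 + 8 * m"
    "output_pairs sampler m B \<beta> \<omega> = sampling \<beta> m (\<omega> 0)"
    using run n by (auto simp: sampler_inv_def)
qed

theorem lemma5:
  shows "\<exists>(P :: program) (T :: nat \<Rightarrow> nat).
    (\<lambda>m. real (T m)) \<in> O(\<lambda>m. real m) \<and>
    (\<forall>(m :: nat) (B :: nat) (\<beta> :: nat \<Rightarrow> real).
       1 \<le> m \<longrightarrow> 1 \<le> B \<longrightarrow> (\<forall>l\<in>{1..m}. \<beta> l \<in> {0..1}) \<longrightarrow> (\<Sum>l=1..m. \<beta> l) \<le> real B \<longrightarrow>
       (\<forall>\<omega>\<in>space uniform_seq.
          terminates P m B \<beta> \<omega> \<and>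
          running_time P m B \<beta> \<omega> \<le> T m \<and>
          is_assignment B m (output_pairs P m B \<beta> \<omega>)) \<and>
       (\<forall>l\<in>{1..m}.
          {\<omega>\<in>space uniform_seq. inspected (output_pairs P m B \<beta> \<omega>) l} \<in> sets uniform_seq \<and>
          measure uniform_seq {\<omega>\<in>space uniform_seq. inspected (output_pairs P m B \<beta> \<omega>) l} = \<beta> l))"
proof (intro exI[of _ sampler] exI[of _ "\<lambda>m. 4 + 8 * m"] conjI allI impI)
  \<comment> \<open>For \<open>m \<ge> 1\<close> one has
    \<open>4 + 8 * m \<le> 12 * m\<close>.\<close>
  show "(\<lambda>m. real (4 + 8 * m)) \<in> O(\<lambda>m. real m)"
    by (intro bigoI[of _ 12] eventually_mono[OF eventually_ge_at_top[of "1::nat"]]) auto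
next
  fix m B :: nat and \<beta> :: "nat \<Rightarrow> real"
  assume m: "1 \<le> m" and \<beta>: "\<forall>l\<in>{1..m}. \<beta> l \<in> {0..1}" and B: "(\<Sum>l=1..m. \<beta> l) \<le> real B"
  have correct: "terminates sampler m B \<beta> \<omega>" "running_time sampler m B \<beta> \<omega> \<le> 4 + 8 * m"
    "output_pairs sampler m B \<beta> \<omega> = sampling \<beta> m (\<omega> 0)" "0 \<le> \<omega> 0"
    if "\<omega> \<in> space uniform_seq" for \<omega>
    using sampler_correct[OF m \<beta>] that by (auto simp: space_uniform_seq)
  show "\<forall>\<omega>\<in>space uniform_seq. terminates sampler m B \<beta> \<omega> \<and>
      running_time sampler m B \<beta> \<omega> \<le> 4 + 8 * m \<and>
      is_assignment B m (output_pairs sampler m B \<beta> \<omega>)"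
    using correct is_assignment_sampling[OF \<beta>] B by (simp add: psum_def)
  have E: "{\<omega>\<in>space uniform_seq. inspected (output_pairs sampler m B \<beta> \<omega>) l} =
      {\<omega>\<in>space uniform_seq. inspected (sampling \<beta> m (\<omega> 0)) l}" for l
    using correct(3) by auto
  show "\<forall>l\<in>{1..m}.
      {\<omega>\<in>space uniform_seq. inspected (output_pairs sampler m B \<beta> \<omega>) l} \<in> sets uniform_seq \<and>
      measure uniform_seq {\<omega>\<in>space uniform_seq. inspected (output_pairs sampler m B \<beta> \<omega>) l} = \<beta> l"
    unfolding E using inspection_probability[OF \<beta>] by blast
qed

end
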